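(* Let $T=(V,E)$ be a tree. For any $u,v\in V$ with $d(u,v)\ge 3$, the intersection inequality $x_{uv}+x_{\vec u(v),\vec v(u)}\le x_{u,\vec v(u)}+x_{\vec u(v),v}$ defines a facet of $\mathrm{LMC}(T)$.
   Context: For a tree $T=(V,E)$ and distinct $u,v\in V$, $d(u,v)$ is the length of the unique $uv$-path $P_{uv}$ in $T$; if $d(u,v)\ge 2$, $\vec u(v)$ denotes the neighbor of $u$ on $P_{uv}$ (and $\vec v(u)$ the neighbor of $v$ on $P_{uv}$). Edges of $T$ are identified with pairs in $\binom{V}{2}$. A decomposition of $T$ is a partition of $V$ each of whose blocks induces a connected subtree; for such a decomposition, its lifted multicut is the set of pairs $ab\in\binom{V}{2}$ with $a,b$ in distinct blocks. $\mathrm{LMC}(T)\subseteq\mathbb{R}^{\binom{V}{2}}$ is the convex hull of the characteristic vectors of these lifted multicuts over all decompositions of $T$. *)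

theory Defs
  imports "HOL-Analysis.Analysis"
begin

definition pairs :: "'v set \<Rightarrow> 'v set set" where
  "pairs V = {e. e \<subseteq> V \<and> card e = 2}"

text \<open>Paths are given by their vertex sequence; the trivial path \<open>[u]\<close> is allowed.\<close>

definition vpath :: "'v set \<Rightarrow> 'v set set \<Rightarrow> 'v \<Rightarrow> 'v list \<Rightarrow> 'v \<Rightarrow> bool" where
  "vpath V E u p v \<longleftrightarrow>
     p \<noteq> [] \<and> hd p = u \<and> last p = v \<and> set p \<subseteq> V \<and> distinct p \<and>
     successively (\<lambda>a b. {a, b} \<in> E) p"

definition connected_graph :: "'v set \<Rightarrow> 'v set set \<Rightarrow> bool" where
  "connected_graph V E \<longleftrightarrow> V \<noteq> {} \<and> (\<forall>u\<in>V. \<forall>v\<in>V. \<exists>p. vpath V E u p v)"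

definition has_cycle :: "'v set \<Rightarrow> 'v set set \<Rightarrow> bool" where
  "has_cycle V E \<longleftrightarrow> (\<exists>u v p. vpath V E u p v \<and> length p \<ge> 3 \<and> {v, u} \<in> E)"

definition tree_graph :: "'v set \<Rightarrow> 'v set set \<Rightarrow> bool" where
  "tree_graph V E \<longleftrightarrow>
     finite V \<and> E \<subseteq> pairs V \<and> connected_graph V E \<and> \<not> has_cycle V E"

definition tree_path :: "'v set \<Rightarrow> 'v set set \<Rightarrow> 'v \<Rightarrow> 'v \<Rightarrow> 'v list" where
  "tree_path V E u v = (THE p. vpath V E u p v)"

definition tree_dist :: "'v set \<Rightarrow> 'v set set \<Rightarrow> 'v \<Rightarrow> 'v \<Rightarrow> nat" where
  "tree_dist V E u v = length (tree_path V E u v) - 1"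

text \<open>The neighbour of \<open>u\<close> on the \<open>uv\<close>-path, meaningful for \<open>u \<noteq> v\<close>.\<close>

definition toward :: "'v set \<Rightarrow> 'v set set \<Rightarrow> 'v \<Rightarrow> 'v \<Rightarrow> 'v" where
  "toward V E u v = tree_path V E u v ! 1"

definition decomposition :: "'v set \<Rightarrow> 'v set set \<Rightarrow> 'v set set \<Rightarrow> bool" where
  "decomposition V E D \<longleftrightarrow>
     partition_on V D \<and> (\<forall>B\<in>D. connected_graph B {e \<in> E. e \<subseteq> B})"

definition lifted_multicut :: "'v set \<Rightarrow> 'v set set \<Rightarrow> 'v set set" where
  "lifted_multicut V D =
     {e \<in> pairs V. \<exists>A\<in>D. \<exists>B\<in>D. A \<noteq> B \<and> (\<exists>a\<in>A. \<exists>b\<in>B. e = {a, b})}"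

text \<open>
  The space of real vectors indexed by \<open>pairs V\<close> is realised as the coordinate subspace
  of \<open>real ^ ('v set)\<close> in which every coordinate outside \<open>pairs V\<close> vanishes. Faces and
  affine dimension are intrinsic to a convex set, so they are unaffected by the embedding.
\<close>

definition char_vec :: "'v::finite set set \<Rightarrow> real ^ ('v set)" where
  "char_vec M = (\<chi> e. if e \<in> M then 1 else 0)"

definition LMC :: "'v::finite set \<Rightarrow> 'v set set \<Rightarrow> (real ^ ('v set)) set" where
  "LMC V E = convex hull {char_vec (lifted_multicut V D) | D. decomposition V E D}"

end

theory Submission
  imports Defs
begin

text \<open>
  Write \<open>K B\<close> for the indicator vector of the pairs inside \<open>B\<close>. The vertex belonging to a
  decomposition \<open>D\<close> is \<open>K V - (\<Sum>B\<in>D. K B)\<close>, and it violates equality iff some block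
  \<open>B\<close> contains \<open>u'\<close> and \<open>v'\<close> but neither \<open>u\<close> nor \<open>v\<close>. For such a block all of
  \<open>B \<union> {u}\<close>, \<open>B \<union> {v}\<close> and \<open>B \<union> {u, v}\<close> are connected, and
  \<open>K B = K (B \<union> {u}) + K (B \<union> {v}) - K (B \<union> {u, v}) + K {u, v}\<close>. Every set on the right other
  than \<open>{u, v}\<close>, and every other block of \<open>D\<close>, is the only nontrivial block of a decomposition
  that satisfies equality. Hence all vertices off the face agree modulo the face, so
  that the polytope lies in the affine hull of the face and the single point \<open>K V - K {u, v}\<close>.
\<close>

subsection \<open>Paths in trees\<close>

lemma vpath_Cons:
  "vpath V E u (x # p) v \<longleftrightarrow>
     x = u \<and> u \<in> V \<and> (if p = [] then u = v
       else u \<notin> set p \<and> {u, hd p} \<in> E \<and> vpath V E (hd p) p v)"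
  by (cases p) (auto simp: vpath_def)

lemma vpath_rev: "vpath V E u p v \<Longrightarrow> vpath V E v (rev p) u"
  by (auto simp: vpath_def hd_rev last_rev insert_commute)

lemma vpath_mono: "vpath V E u p v \<Longrightarrow> V \<subseteq> V' \<Longrightarrow> E \<subseteq> E' \<Longrightarrow> vpath V' E' u p v"
  by (auto simp: vpath_def intro: successively_mono)

lemma vpath_snoc:
  "vpath V E u p v \<Longrightarrow> w \<in> V \<Longrightarrow> w \<notin> set p \<Longrightarrow> {v, w} \<in> E \<Longrightarrow> vpath V E u (p @ [w]) w"
  by (auto simp: vpath_def successively_append_iff)

text \<open>Induction along \<open>p\<close>: once the second vertices agree, the tails are handled
  by the induction hypothesis. If they differed, the two tails, which both end in \<open>v\<close>,
  would meet again and close a cycle through \<open>u\<close>.\<close>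

lemma vpath_unique:
  assumes "\<not> has_cycle V E" and "vpath V E u p v" and "vpath V E u q v"
  shows "p = q"
  using assms(2,3)
proof (induction p arbitrary: u q)
  case Nil
  then show ?case by (simp add: vpath_def)
next
  case (Cons x p)
  have x: "x = u" using Cons.prems by (simp add: vpath_def)
  obtain q' where q: "q = u # q'"
    using Cons.prems(2) by (cases q) (auto simp: vpath_def)
  show ?case
  proof (cases "u = v")
    case True
    with Cons.prems show ?thesis
      unfolding q x by (auto simp: vpath_def split: if_splits)
  next
    case False
    then have p': "u \<notin> set p" "{u, hd p} \<in> E" "vpath V E (hd p) p v" "u \<in> V"
      and q': "u \<notin> set q'" "{u, hd q'} \<in> E" "vpath V E (hd q') q' v"
      using Cons.prems unfolding q by (auto simp: vpath_Cons split: if_splits)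
    have "hd p = hd q'"
    proof (rule ccontr)
      assume ne: "hd p \<noteq> hd q'"
      have "\<exists>y\<in>set p. y \<in> set q'"
        using p'(3) q'(3) unfolding vpath_def by (metis last_in_set)
      then obtain p1 w p2 where p: "p = p1 @ w # p2" "w \<in> set q'" "\<forall>y\<in>set p1. y \<notin> set q'"
        using split_list_first_prop[of p "\<lambda>y. y \<in> set q'"] by blast
      then obtain q1 q2 where q1: "q' = q1 @ w # q2"
        by (meson split_list)
      \<comment> \<open>From \<open>u\<close> along \<open>p\<close> to \<open>w\<close>, then back
        along \<open>q'\<close> to its head. As \<open>w\<close> is the first vertex of
        \<open>p\<close> on \<open>q'\<close>, no vertex repeats. Differing heads rule out that
        \<open>p1\<close> and \<open>q1\<close> are both empty, so there are at least three
        vertices.\<close>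
      define c where "c = u # p1 @ [w] @ rev q1"
      have "vpath V E u c (hd q')"
        using p'(3,4,1,2) q'(1,2,3) p(3) unfolding vpath_def c_def p(1) q1
        by (auto simp: successively_append_iff successively_Cons hd_rev last_rev insert_commute
            hd_append split: if_splits)
      moreover have "length c \<ge> 3"
        using ne unfolding c_def p(1) q1 by (cases p1; cases q1) auto
      moreover have "{hd q', u} \<in> E" using q'(2) by (simp add: insert_commute)
      ultimately show False using assms(1) unfolding has_cycle_def by blast
    qed
    then show ?thesis using Cons.IH p'(3) q'(3) q x by simp
  qed
qed

lemma tree_path_eq:
  assumes "tree_graph V E" and "vpath V E u p v"
  shows "tree_path V E u v = p"
  unfolding tree_path_def
  using assms vpath_unique by (metis (no_types, lifting) the_equality tree_graph_def)

text \<open>A path inside \<open>B\<close> is also a path of the whole graph, hence by uniqueness it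
  is \<open>p\<close> itself. This is the convexity of connected blocks that the intersection
  inequality rests on.\<close>

lemma connected_subgraph_contains_path:
  assumes "\<not> has_cycle V E" and "B \<subseteq> V" and "connected_graph B {e \<in> E. e \<subseteq> B}"
    and "a \<in> B" and "b \<in> B" and "vpath V E a p b"
  shows "set p \<subseteq> B"
proof -
  obtain q where q: "vpath B {e \<in> E. e \<subseteq> B} a q b"
    using assms unfolding connected_graph_def by blast
  then have "vpath V E a q b" using assms(2) by (auto intro: vpath_mono)
  then have "p = q" using assms vpath_unique by metis
  then show ?thesis using q by (simp add: vpath_def)
qed

lemma connected_graph_singleton: "connected_graph {w} F"
  unfolding connected_graph_def vpath_def by (auto intro!: exI[of _ "[w]"])

lemma connected_graph_insert:
  assumes "connected_graph B {e \<in> E. e \<subseteq> B}" and "x \<in> B" and "{w, x} \<in> E"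
  shows "connected_graph (insert w B) {e \<in> E. e \<subseteq> insert w B}"
proof (cases "w \<in> B")
  case True
  then show ?thesis using assms(1) by (simp add: insert_absorb)
next
  case False
  let ?V = "insert w B" and ?E = "{e \<in> E. e \<subseteq> insert w B}"
  \<comment> \<open>The bound \<open>set p \<subseteq> B\<close> is recorded so that
    \<open>w\<close> can later be appended to the path without repetition.\<close>
  have old: "\<exists>p. vpath ?V ?E a p b \<and> set p \<subseteq> B" if ab: "a \<in> B" "b \<in> B" for a b
  proof -
    obtain p where p: "vpath B {e \<in> E. e \<subseteq> B} a p b"
      using assms(1) ab unfolding connected_graph_def by blast
    then have "vpath ?V ?E a p b" by (rule vpath_mono) auto
    moreover have "set p \<subseteq> B" using p by (simp add: vpath_def)
    ultimately show ?thesis by blast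
  qed
  have to_w: "\<exists>p. vpath ?V ?E b p w" if b: "b \<in> B" for b
  proof -
    obtain p where "vpath ?V ?E b p x" "set p \<subseteq> B" using old b assms(2) by blast
    then have "vpath ?V ?E b (p @ [w]) w"
      using False assms(2,3) by (intro vpath_snoc) (auto simp: insert_commute)
    then show ?thesis by blast
  qed
  have "\<exists>p. vpath ?V ?E w p w" by (auto intro!: exI[of _ "[w]"] simp: vpath_def)
  moreover have "\<exists>p. vpath ?V ?E w p b" if "b \<in> B" for b
    using to_w[OF that] by (auto dest: vpath_rev)
  ultimately have "\<exists>p. vpath ?V ?E a p b" if "a \<in> ?V" "b \<in> ?V" for a b
    using that old[of a b] to_w[of a] by auto
  then show ?thesis unfolding connected_graph_def by blast
qed

lemma connected_graph_path:
  assumes "vpath V E a p b"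
  shows "connected_graph (set p) {e \<in> E. e \<subseteq> set p}"
  using assms
proof (induction p arbitrary: a)
  case Nil
  then show ?case by (simp add: vpath_def)
next
  case (Cons x p)
  show ?case
  proof (cases "p = []")
    case True
    then show ?thesis by (simp add: connected_graph_singleton)
  next
    case False
    then have "vpath V E (hd p) p b" "{x, hd p} \<in> E"
      using Cons.prems by (auto simp: vpath_Cons)
    then show ?thesis
      using Cons.IH False connected_graph_insert[of "set p" E "hd p" x] by simp
  qed
qed

subsection \<open>Vertices of the lifted multicut polytope\<close>

lemma pair_in_pairs: "a \<noteq> b \<Longrightarrow> {a, b} \<in> pairs V \<longleftrightarrow> a \<in> V \<and> b \<in> V"
  by (auto simp: pairs_def)

lemma pairsE:
  assumes "e \<in> pairs V"
  obtains a b where "e = {a, b}" "a \<noteq> b" "a \<in> V" "b \<in> V"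
  using assms by (auto simp: pairs_def card_2_iff)

lemma partition_on_block_unique:
  "partition_on V D \<Longrightarrow> A \<in> D \<Longrightarrow> B \<in> D \<Longrightarrow> w \<in> A \<Longrightarrow> w \<in> B \<Longrightarrow> A = B"
  by (auto simp: partition_on_def disjoint_def)

lemma lifted_multicut_eq:
  assumes "partition_on V D"
  shows "lifted_multicut V D = pairs V - \<Union> (pairs ` D)"
proof (intro equalityI subsetI)
  fix e assume "e \<in> lifted_multicut V D"
  then obtain A B a b where "e \<in> pairs V" "A \<in> D" "B \<in> D" "A \<noteq> B" "a \<in> A" "b \<in> B" "e = {a, b}"
    unfolding lifted_multicut_def by blast
  moreover have "e \<notin> pairs C" if "C \<in> D" for C
    using calculation that partition_on_block_unique[OF assms, of C]
    by (metis (no_types, lifting) insertCI mem_Collect_eq pairs_def subsetD)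
  ultimately show "e \<in> pairs V - \<Union> (pairs ` D)" by blast
next
  fix e assume e: "e \<in> pairs V - \<Union> (pairs ` D)"
  then obtain a b where ab: "e = {a, b}" "a \<noteq> b" "a \<in> V" "b \<in> V" by (auto elim: pairsE)
  then obtain A B where "A \<in> D" "B \<in> D" "a \<in> A" "b \<in> B"
    using partition_onD1[OF assms] by auto
  moreover have "A \<noteq> B" using calculation e ab by (auto simp: pair_in_pairs)
  ultimately show "e \<in> lifted_multicut V D"
    using e ab unfolding lifted_multicut_def by blast
qed

text \<open>Blocks are disjoint, so a pair lies inside at most one of them and the sum takes only
  the values 0 and 1. This additive form lets linear arguments proceed block by block.\<close>

lemma char_vec_lifted_multicut:
  assumes "partition_on V D"
  shows "char_vec (lifted_multicut V D) = char_vec (pairs V) - (\<Sum>B\<in>D. char_vec (pairs B))"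
proof -
  have "(\<Sum>B\<in>D. if e \<in> pairs B then 1 else (0::real)) = (if e \<in> \<Union> (pairs ` D) then 1 else 0)" for e
  proof (cases "e \<in> \<Union> (pairs ` D)")
    case True
    then obtain B where B: "B \<in> D" "e \<in> pairs B" by blast
    have "e \<in> pairs C \<longleftrightarrow> C = B" if "C \<in> D" for C
    proof
      assume "e \<in> pairs C"
      then obtain a where "a \<in> e" "a \<in> C" by (rule pairsE) blast
      then show "C = B"
        using B that partition_on_block_unique[OF assms] by (auto simp: pairs_def)
    qed (use B in simp)
    then have "(\<Sum>C\<in>D. if e \<in> pairs C then 1 else (0::real)) = (\<Sum>C\<in>D. if C = B then 1 else 0)"
      by (intro sum.cong) auto
    then show ?thesis using B True by simp
  next
    case False
    then show ?thesis by (auto intro: sum.neutral)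
  qed
  moreover have "\<Union> (pairs ` D) \<subseteq> pairs V"
    using partition_onD1[OF assms] by (auto simp: pairs_def)
  ultimately show ?thesis
    unfolding lifted_multicut_eq[OF assms]
    by (auto simp: vec_eq_iff char_vec_def)
qed

lemma char_vec_lifted_multicut_nth:
  assumes "partition_on V D" and "a \<in> V" and "b \<in> V" and "a \<noteq> b"
  shows "char_vec (lifted_multicut V D) $ {a, b} = (if \<exists>B\<in>D. a \<in> B \<and> b \<in> B then 0 else 1)"
  using assms by (auto simp: lifted_multicut_eq char_vec_def pair_in_pairs)

text \<open>Singletons are connected and contain no pairs, so every connected \<open>B\<close>
  yields a vertex to which only \<open>B\<close> contributes.\<close>

definition single_block :: "'v set \<Rightarrow> 'v set \<Rightarrow> 'v set set" where
  "single_block V B = insert B ((\<lambda>w. {w}) ` (V - B))"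

lemma decomposition_single_block:
  assumes "connected_graph B {e \<in> E. e \<subseteq> B}" and "B \<subseteq> V"
  shows "decomposition V E (single_block V B)"
  using assms unfolding decomposition_def single_block_def partition_on_def disjoint_def
  \<comment> \<open>Connectedness includes nonemptiness, which keeps the empty set out of the
    partition.\<close>
  by (auto simp: connected_graph_singleton) (simp add: connected_graph_def)

lemma char_vec_single_block:
  assumes "partition_on V (single_block V B)"
  shows "char_vec (lifted_multicut V (single_block V B)) = char_vec (pairs V) - char_vec (pairs B)"
proof -
  have "pairs {w} = {}" for w :: 'a by (auto elim!: pairsE)
  then have "\<Union> (pairs ` single_block V B) = pairs B"
    by (auto simp: single_block_def)
  moreover have "pairs B \<subseteq> pairs V"
    using partition_onD1[OF assms] by (auto simp: pairs_def single_block_def)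
  ultimately show ?thesis
    by (auto simp: lifted_multicut_eq[OF assms] vec_eq_iff char_vec_def)
qed

text \<open>Inclusion-exclusion: the pairs inside both \<open>insert u B\<close> and
  \<open>insert v B\<close> are those inside \<open>B\<close>, and together these two sets miss
  exactly \<open>{u, v}\<close> among the pairs of \<open>insert u (insert v B)\<close>.\<close>

lemma char_vec_pairs_insert2:
  assumes "u \<notin> B" and "v \<notin> B" and "u \<noteq> v"
  shows "char_vec (pairs B) = char_vec (pairs (insert u B)) + char_vec (pairs (insert v B))
           - char_vec (pairs (insert u (insert v B))) + char_vec {{u, v}}"
proof -
  have "e \<in> pairs B \<longleftrightarrow> e \<in> pairs (insert u B) \<and> e \<in> pairs (insert v B)" for e
    using assms by (auto simp: pairs_def)
  moreover have "e = {u, v} \<longleftrightarrow> e \<in> pairs (insert u (insert v B))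
      \<and> e \<notin> pairs (insert u B) \<and> e \<notin> pairs (insert v B)" for e
    using assms by (auto simp: pair_in_pairs elim!: pairsE)
  moreover have "e \<in> pairs (insert u (insert v B))"
    if "e \<in> pairs (insert u B) \<or> e \<in> pairs (insert v B)" for e
    using that by (auto simp: pairs_def)
  ultimately show ?thesis by (simp add: vec_eq_iff char_vec_def)
qed

subsection \<open>The intersection inequality\<close>

text \<open>The path structure is condensed into three convexity conditions on connected sets. The
  edges allow a separating block to grow by \<open>u\<close> or \<open>v\<close>, and
  \<open>middle\<close> supplies a vertex off the face.\<close>

locale intersection_inequality =
  fixes V :: "'v::finite set" and E :: "'v set set" and u v u' v' :: 'v
  assumes in_V: "u \<in> V" "v \<in> V" "u' \<in> V" "v' \<in> V"
    and distinct_ends: "distinct [u, u', v', v]"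
    and edges: "{u, u'} \<in> E" "{v, v'} \<in> E"
    and convex_u: "\<And>B. \<lbrakk>B \<subseteq> V; connected_graph B {e \<in> E. e \<subseteq> B}; u \<in> B; v' \<in> B\<rbrakk> \<Longrightarrow> u' \<in> B"
    and convex_v: "\<And>B. \<lbrakk>B \<subseteq> V; connected_graph B {e \<in> E. e \<subseteq> B}; u' \<in> B; v \<in> B\<rbrakk> \<Longrightarrow> v' \<in> B"
    and convex_uv: "\<And>B. \<lbrakk>B \<subseteq> V; connected_graph B {e \<in> E. e \<subseteq> B}; u \<in> B; v \<in> B\<rbrakk>
                      \<Longrightarrow> u' \<in> B \<and> v' \<in> B"
    and middle: "\<exists>B\<subseteq>V. connected_graph B {e \<in> E. e \<subseteq> B} \<and> u' \<in> B \<and> v' \<in> B \<and> u \<notin> B \<and> v \<notin> B"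
begin

definition face :: "(real ^ 'v set) set" where
  "face = {x \<in> LMC V E. x $ {u, v} + x $ {u', v'} = x $ {u, v'} + x $ {u', v}}"

definition separating :: "'v set \<Rightarrow> bool" where
  "separating B \<longleftrightarrow> u' \<in> B \<and> v' \<in> B \<and> u \<notin> B \<and> v \<notin> B"

lemma vertex_in_LMC: "decomposition V E D \<Longrightarrow> char_vec (lifted_multicut V D) \<in> LMC V E"
  unfolding LMC_def by (rule hull_inc) blast

text \<open>Let \<open>A\<close> and \<open>B\<close> be the blocks of \<open>u'\<close> and
  \<open>v'\<close>. If they differ, convexity makes all four coordinates 1 and the slack vanishes.
  If they agree, with a and b the 0/1 indicators of \<open>u\<close> and \<open>v\<close> lying in
  \<open>A\<close>, the slack is (1 - a) + (1 - b) - (1 - a b) = (1 - a)(1 - b).\<close>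

lemma slack_vertex:
  assumes "decomposition V E D"
  defines "x \<equiv> char_vec (lifted_multicut V D)"
  shows "x $ {u, v'} + x $ {u', v} - x $ {u, v} - x $ {u', v'} = (if \<exists>B\<in>D. separating B then 1 else 0)"
proof -
  have part: "partition_on V D" and conn: "\<And>B. B \<in> D \<Longrightarrow> connected_graph B {e \<in> E. e \<subseteq> B}"
    using assms(1) unfolding decomposition_def by auto
  have sub: "B \<subseteq> V" if "B \<in> D" for B using part that by (auto simp: partition_on_def)
  have same: "A = B" if "A \<in> D" "B \<in> D" "w \<in> A" "w \<in> B" for A B w
    using partition_on_block_unique[OF part] that by blast
  obtain A B where A: "A \<in> D" "u' \<in> A" and B: "B \<in> D" "v' \<in> B"
    using in_V partition_onD1[OF part] by auto
  have uv': "(\<exists>C\<in>D. u \<in> C \<and> v' \<in> C) \<longleftrightarrow> u \<in> A \<and> A = B"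
    using A B same convex_u[OF sub conn] by metis
  have u'v: "(\<exists>C\<in>D. u' \<in> C \<and> v \<in> C) \<longleftrightarrow> v \<in> A \<and> A = B"
    using A B same convex_v[OF sub conn] by metis
  have uv: "(\<exists>C\<in>D. u \<in> C \<and> v \<in> C) \<longleftrightarrow> u \<in> A \<and> v \<in> A \<and> A = B"
    using A B same convex_uv[OF sub conn] by metis
  have u'v': "(\<exists>C\<in>D. u' \<in> C \<and> v' \<in> C) \<longleftrightarrow> A = B"
    using A B same by metis
  have sep: "(\<exists>C\<in>D. separating C) \<longleftrightarrow> A = B \<and> u \<notin> A \<and> v \<notin> A"
    unfolding separating_def using A B same by metis
  show ?thesis
    using distinct_ends in_V
    by (auto simp: x_def char_vec_lifted_multicut_nth[OF part] uv' u'v uv u'v' sep)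
qed

lemma inequality: "x \<in> LMC V E \<Longrightarrow> x $ {u, v} + x $ {u', v'} \<le> x $ {u, v'} + x $ {u', v}"
proof -
  let ?H = "{x :: real ^ 'v set. x $ {u, v} + x $ {u', v'} \<le> x $ {u, v'} + x $ {u', v}}"
  have "convex ?H"
  proof (rule convexI)
    fix x y :: "real ^ 'v set" and s t :: real
    assume "x \<in> ?H" "y \<in> ?H" "0 \<le> s" "0 \<le> t"
    then have "s * (x $ {u, v} + x $ {u', v'}) \<le> s * (x $ {u, v'} + x $ {u', v})"
      "t * (y $ {u, v} + y $ {u', v'}) \<le> t * (y $ {u, v'} + y $ {u', v})"
      by (auto intro: mult_left_mono)
    then show "s *\<^sub>R x + t *\<^sub>R y \<in> ?H" by (simp add: algebra_simps)
  qed
  moreover have "{char_vec (lifted_multicut V D) | D. decomposition V E D} \<subseteq> ?H"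
    using slack_vertex by (fastforce split: if_splits)
  ultimately have "LMC V E \<subseteq> ?H" unfolding LMC_def by (rule hull_minimal[rotated])
  then show "x \<in> LMC V E \<Longrightarrow> ?thesis" by blast
qed

lemma vertex_in_face_iff:
  assumes "decomposition V E D"
  shows "char_vec (lifted_multicut V D) \<in> face \<longleftrightarrow> \<not> (\<exists>B\<in>D. separating B)"
  using slack_vertex[OF assms] vertex_in_LMC[OF assms] by (auto simp: face_def split: if_splits)

lemma block_in_face:
  assumes "connected_graph B {e \<in> E. e \<subseteq> B}" and "B \<subseteq> V" and "\<not> separating B"
  shows "char_vec (pairs V) - char_vec (pairs B) \<in> face"
proof -
  have dec: "decomposition V E (single_block V B)"
    using assms by (simp add: decomposition_single_block)
  have "\<not> separating {w}" for w using distinct_ends by (auto simp: separating_def)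
  then have "char_vec (lifted_multicut V (single_block V B)) \<in> face"
    using assms(3) vertex_in_face_iff[OF dec] by (auto simp: single_block_def)
  then show ?thesis
    using dec char_vec_single_block by (metis decomposition_def)
qed

section \<open>The face and its dimension\<close>

lemma face_of_LMC: "face face_of LMC V E"
proof -
  define c :: "real ^ 'v set" where
    "c = axis {u, v} 1 + axis {u', v'} 1 - axis {u, v'} 1 - axis {u', v} 1"
  have c: "c \<bullet> x = x $ {u, v} + x $ {u', v'} - x $ {u, v'} - x $ {u', v}" for x
    by (simp add: c_def inner_add_left inner_diff_left inner_axis')
  have "LMC V E \<inter> {x. c \<bullet> x = 0} face_of LMC V E"
    by (rule face_of_Int_supporting_hyperplane_le)
      (use inequality in \<open>force simp: c LMC_def convex_convex_hull\<close>)+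
  moreover have "LMC V E \<inter> {x. c \<bullet> x = 0} = face"
    by (auto simp: face_def c)
  ultimately show ?thesis by simp
qed

lemma face_neq_LMC: "face \<noteq> LMC V E"
proof -
  obtain B where B: "B \<subseteq> V" "connected_graph B {e \<in> E. e \<subseteq> B}" "separating B"
    using middle by (auto simp: separating_def)
  then have dec: "decomposition V E (single_block V B)"
    by (simp add: decomposition_single_block)
  have "B \<in> single_block V B" by (simp add: single_block_def)
  then show ?thesis
    using B(3) vertex_in_LMC[OF dec] vertex_in_face_iff[OF dec] by blast
qed

lemma LMC_subset_affine_hull:
  "LMC V E \<subseteq> affine hull (insert (char_vec (pairs V) - char_vec {{u, v}}) face)"
    (is "_ \<subseteq> ?H")
proof -
  let ?K = "\<lambda>B :: 'v set. char_vec (pairs B)"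
  \<comment> \<open>Up to sign, \<open>S\<close> is the affine hull translated by
    \<open>?K V\<close>. Once \<open>?K V\<close> is known to lie in the hull, \<open>S\<close> is a
    linear subspace and membership can be checked for each block separately.\<close>
  define S where "S = {k. ?K V - k \<in> ?H}"
  have "pairs {u} = {}" by (auto elim!: pairsE)
  then have "?K {u} = 0" by (simp add: char_vec_def vec_eq_iff)
  moreover have face_S: "?K B \<in> S"
    if "connected_graph B {e \<in> E. e \<subseteq> B}" "B \<subseteq> V" "\<not> separating B" for B
    unfolding S_def using block_in_face[OF that] by (auto intro: hull_inc)
  \<comment> \<open>The block \<open>{u}\<close> gives the decomposition into singletons, whose
    vertex \<open>?K V\<close> lies on the face.\<close>
  ultimately have "0 \<in> S"
    using face_S[of "{u}"] in_V by (simp add: connected_graph_singleton separating_def)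
  then have V_in: "?K V \<in> ?H" by (simp add: S_def)
  have "subspace ((\<lambda>x. x - ?K V) ` ?H)"
    using affine_diffs_subspace_subtract[OF affine_affine_hull V_in] .
  then have "subspace (uminus ` (\<lambda>x. x - ?K V) ` ?H)"
    by (rule linear_subspace_image[OF linear_uminus])
  moreover have "uminus ` (\<lambda>x. x - ?K V) ` ?H = S"
    unfolding S_def image_image by (auto intro: image_eqI[where x="?K V - _"])
  ultimately have S: "subspace S" by simp
  \<comment> \<open>The extra point was chosen to supply the one term of the inclusion-exclusion
    identity that no face vertex provides directly.\<close>
  have uv_S: "char_vec {{u, v}} \<in> S" unfolding S_def by (auto intro: hull_inc)
  have block_S: "?K B \<in> S" if B: "connected_graph B {e \<in> E. e \<subseteq> B}" "B \<subseteq> V" for B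
  proof (cases "separating B")
    case True
    then have B': "u' \<in> B" "v' \<in> B" "u \<notin> B" "v \<notin> B" by (auto simp: separating_def)
    have conn_v: "connected_graph (insert v B) {e \<in> E. e \<subseteq> insert v B}"
      using connected_graph_insert[OF B(1) B'(2) edges(2)] .
    have "?K (insert u B) \<in> S"
      using B B' in_V connected_graph_insert[OF B(1) B'(1) edges(1)]
      by (intro face_S) (auto simp: separating_def)
    moreover have "?K (insert v B) \<in> S"
      using B B' in_V conn_v by (intro face_S) (auto simp: separating_def)
    \<comment> \<open>\<open>u\<close> need not be adjacent to \<open>v\<close>: it is attached to
      the connected set \<open>insert v B\<close> through \<open>u'\<close>.\<close>
    moreover have "?K (insert u (insert v B)) \<in> S"
      using B B' in_V connected_graph_insert[OF conn_v _ edges(1)]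
      by (intro face_S) (auto simp: separating_def)
    ultimately show ?thesis
      using char_vec_pairs_insert2[OF B'(3,4)] distinct_ends S uv_S
      by (simp add: subspace_add subspace_diff)
  qed (use B face_S in blast)
  have "char_vec (lifted_multicut V D) \<in> ?H" if "decomposition V E D" for D
  proof -
    have D: "partition_on V D" "\<And>B. B \<in> D \<Longrightarrow> ?K B \<in> S"
      using that block_S unfolding decomposition_def partition_on_def by auto
    then have "(\<Sum>B\<in>D. ?K B) \<in> S" using S by (simp add: subspace_sum)
    then show ?thesis by (simp add: S_def char_vec_lifted_multicut[OF D(1)])
  qed
  then show ?thesis
    unfolding LMC_def by (intro hull_minimal affine_imp_convex affine_affine_hull) auto
qed

text \<open>The dimension is squeezed: a proper face of a convex set has smaller dimension, while
  adding a single point to the face raises its dimension by at most one and already spans the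
  polytope.\<close>

theorem face_facet_of_LMC: "face facet_of LMC V E"
proof -
  have "convex (LMC V E)" by (simp add: LMC_def)
  then have "aff_dim face < aff_dim (LMC V E)"
    using face_of_aff_dim_lt face_of_LMC face_neq_LMC by blast
  moreover have "aff_dim (LMC V E) \<le> aff_dim face + 1"
    using aff_dim_subset[OF LMC_subset_affine_hull]
    by (simp add: aff_dim_affine_hull aff_dim_insert split: if_splits)
  moreover have "face \<noteq> {}"
    using block_in_face[of "{u}"] in_V by (auto simp: connected_graph_singleton separating_def)
  ultimately show ?thesis using face_of_LMC by (simp add: facet_of_def)
qed

end

section \<open>Specialization to paths in a tree\<close>

lemma tree_path_intersection_inequality:
  fixes V :: "'v::finite set"
  assumes tree: "tree_graph V E" and "u \<in> V" and "v \<in> V" and dist: "tree_dist V E u v \<ge> 3"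
  shows "intersection_inequality V E u v (toward V E u v) (toward V E v u)"
proof -
  have acyc: "\<not> has_cycle V E" using tree by (simp add: tree_graph_def)
  obtain p where p: "vpath V E u p v"
    using assms unfolding tree_graph_def connected_graph_def by blast
  have path: "tree_path V E u v = p" "tree_path V E v u = rev p"
    using tree_path_eq[OF tree] p vpath_rev[OF p] by auto
  \<comment> \<open>Distance counts edges and the list counts vertices. Distance at least 3 thus
    leaves two interior vertices, so that \<open>hd q\<close> and \<open>last q\<close> are
    distinct.\<close>
  then have len: "length p \<ge> 4" using dist by (simp add: tree_dist_def)
  then obtain q where q: "p = u # q @ [v]" "length q \<ge> 2"
    using p unfolding vpath_def
    by (cases p; cases "tl p" rule: rev_cases) auto
  have u': "toward V E u v = hd q"
    using q unfolding toward_def path by (cases q) auto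
  have v': "toward V E v u = last q"
    using q unfolding toward_def path by (cases q rule: rev_cases) auto
  have q_ne: "q \<noteq> []" using q by auto
  have dist_ends: "hd q \<noteq> last q"
    using q(2) p unfolding q(1) vpath_def by (cases q) (auto split: if_splits)
  have mid: "vpath V E (hd q) q (last q)" and left: "vpath V E u (u # q) (last q)"
    and right: "vpath V E (hd q) (q @ [v]) v"
    and edges: "{u, hd q} \<in> E" "{v, last q} \<in> E" and nin: "u \<notin> set q" "v \<notin> set q" "u \<noteq> v"
    using p q_ne unfolding q(1) vpath_def
    by (auto simp: successively_Cons successively_append_iff insert_commute)
  have inq: "hd q \<in> set q" "last q \<in> set q" using q_ne by auto
  have sub: "set q \<subseteq> V" using mid by (simp add: vpath_def)
  show ?thesis
    unfolding u' v'
  proof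
    fix B assume B: "B \<subseteq> V" "connected_graph B {e \<in> E. e \<subseteq> B}"
    note contains = connected_subgraph_contains_path[OF acyc B]
    show "hd q \<in> B" if "u \<in> B" "last q \<in> B"
      using contains[OF that left] inq by auto
    show "last q \<in> B" if "hd q \<in> B" "v \<in> B"
      using contains[OF that right] inq by auto
    show "hd q \<in> B \<and> last q \<in> B" if "u \<in> B" "v \<in> B"
      using contains[OF that p] inq by (auto simp: q)
  next
    show "\<exists>B\<subseteq>V. connected_graph B {e \<in> E. e \<subseteq> B} \<and> hd q \<in> B \<and> last q \<in> B \<and> u \<notin> B \<and> v \<notin> B"
      \<comment> \<open>The interior \<open>set q\<close> of the path serves as the connected set
        that avoids both ends.\<close>
      using connected_graph_path[OF mid] sub inq nin by blast
    show "distinct [u, hd q, last q, v]" using inq nin dist_ends by auto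
  qed (use assms sub inq edges in auto)
qed

theorem theorem6p10:
  fixes V :: "'v::finite set" and E :: "'v set set" and u v u' v' :: 'v
  assumes "tree_graph V E"
    and "u \<in> V" and "v \<in> V"
    and "tree_dist V E u v \<ge> 3"
    and "u' = toward V E u v" and "v' = toward V E v u"
  shows "(\<forall>x \<in> LMC V E. x $ {u, v} + x $ {u', v'} \<le> x $ {u, v'} + x $ {u', v}) \<and>
         {x \<in> LMC V E. x $ {u, v} + x $ {u', v'} = x $ {u, v'} + x $ {u', v}}
           facet_of LMC V E"
proof -
  interpret intersection_inequality V E u v u' v'
    using tree_path_intersection_inequality assms by blast
  show ?thesis
    using inequality face_facet_of_LMC unfolding face_def by blast
qed

end
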